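(* For $X\ge 1$ let $R(X)$ be the number of connected components of $\Gamma$ that meet $[1,X]$. As $X\to\infty$: (i) Unconditionally, $$R(X)\le \log X+2\gamma+O(X^{-1/4}).$$ (ii) More generally, if $(\theta,a)$ is an admissible pointwise divisor pair, then $$R(X)\le \log X+2\gamma+O\!\left(X^{-(1-\theta)/2}(\log X)^{a/2}\right).$$ (iii) If $\theta$ is admissible in the exponent-only sense, then for every $\varepsilon>0$, $$R(X)\le \log X+2\gamma+O_\varepsilon\!\left(X^{-(1-\theta)/2+\varepsilon}\right).$$
   Context: $\mathbb N=\{1,2,3,\dots\}$; $\tau(n)$ is the number of positive divisors of $n$; $T(n)=n+\tau(n)$. $\Gamma$ is the undirected graph with vertex set $\mathbb N$ and edge set $\{\{n,T(n)\}:n\in\mathbb N\}$. $\gamma$ is Euler's constant; $\log$ is the natural logarithm. Let $$\Delta(x)=\sum_{n\le x}\tau(n)-x\log x-(2\gamma-1)x.$$ A pair $(\theta,a)$ with $0<\theta<1$ and $a\ge0$ is called an admissible pointwise divisor pair if $\Delta(x)=O(x^\theta(\log x)^a)$ as $x\to\infty$. An exponent $\theta\in(0,1)$ is called admissible in the exponent-only sense if $\Delta(x)=O_\varepsilon(x^{\theta+\varepsilon})$ for every $\varepsilon>0$. *)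

theory Defs
  imports
    "HOL-Analysis.Harmonic_Numbers"
    "HOL-Library.Landau_Symbols"
    "Graph_Theory.Digraph_Component"
begin

definition divisor_count :: "nat \<Rightarrow> nat" where
  "divisor_count n = card {d. d dvd n}"

definition T :: "nat \<Rightarrow> nat" where
  "T n = n + divisor_count n"

text \<open>
  The vertices are the positive integers. As usual in Graph_Theory, an undirected graph
  is a symmetric digraph: \<open>u\<close> and \<open>v\<close> are joined by a pair of opposite arcs iff the
  unordered pair \<open>{u, v}\<close> is an edge.
\<close>

definition \<Gamma> :: "nat pair_pre_digraph" where
  "\<Gamma> = \<lparr>pverts = {n. n > 0}, parcs = {(u, v). \<exists>n>0. {u, v} = {n, T n}}\<rparr>"

lemma pair_sym_digraph_\<Gamma>: "pair_sym_digraph \<Gamma>"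
proof
  fix e assume "e \<in> parcs \<Gamma>"
  then show "fst e \<in> pverts \<Gamma>" "snd e \<in> pverts \<Gamma>"
    by (auto simp: \<Gamma>_def T_def doubleton_eq_iff)
next
  show "symmetric (with_proj \<Gamma>)"
    by (auto simp: symmetric_def \<Gamma>_def intro!: symI simp: insert_commute)
qed

text \<open>
  The strongly connected components of a symmetric digraph are the connected components
  of the underlying undirected graph; \<open>sccs_verts\<close> gives them as sets of vertices.
\<close>

definition R :: "real \<Rightarrow> nat" where
  "R X = card {C \<in> pre_digraph.sccs_verts (with_proj \<Gamma>). real ` C \<inter> {1..X} \<noteq> {}}"

definition \<Delta> :: "real \<Rightarrow> real" where
  "\<Delta> x = (\<Sum>n | n > 0 \<and> real n \<le> x. real (divisor_count n))
           - x * ln x - (2 * euler_mascheroni - 1) * x"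

definition admissible_pair :: "real \<Rightarrow> real \<Rightarrow> bool" where
  "admissible_pair \<theta> a \<longleftrightarrow> 0 < \<theta> \<and> \<theta> < 1 \<and> a \<ge> 0 \<and>
     \<Delta> \<in> O[at_top](\<lambda>x. x powr \<theta> * ln x powr a)"

definition admissible_exponent :: "real \<Rightarrow> bool" where
  "admissible_exponent \<theta> \<longleftrightarrow> 0 < \<theta> \<and> \<theta> < 1 \<and>
     (\<forall>\<epsilon>>0. \<Delta> \<in> O[at_top](\<lambda>x. x powr (\<theta> + \<epsilon>)))"

text \<open>
  \<open>R X \<le> ln X + 2 \<gamma> + O(g X)\<close> as \<open>X \<rightarrow> \<infinity>\<close>: the inequality holds up to an error
  function of order \<open>O(g)\<close>. Since \<open>E\<close> is otherwise arbitrary, asking for the inequality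
  on all of \<open>X \<ge> 1\<close> is the same as asking for it eventually.
\<close>

definition R_bound :: "(real \<Rightarrow> real) \<Rightarrow> bool" where
  "R_bound g \<longleftrightarrow> (\<exists>E. E \<in> O[at_top](g) \<and>
     (\<forall>X\<ge>1. real (R X) \<le> ln X + 2 * euler_mascheroni + E X))"

end

theory Submission
  imports Defs "HOL-Computational_Algebra.Primes" "HOL-Real_Asymp.Real_Asymp"
begin

text \<open>
  Every component of \<open>\<Gamma>\<close> is closed under \<open>T\<close> and hence contains an orbit running to infinity.
  An orbit crossing a window \<open>(X, X + H]\<close> advances by \<open>\<tau>(n)\<close> from each visited \<open>n\<close>, so the values
  \<open>\<tau>(n)\<close> at its points in the window add up to the length \<open>H\<close>, except for the overshoot when it
  enters; the overshoot is at most \<open>M = max {\<tau>(n) | n \<le> X}\<close>. Distinct components are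
  disjoint, so each of the \<open>R(X)\<close> components meeting \<open>[1, X]\<close> uses up its own share \<open>H - M\<close> of the
  divisor sum over the window (lemma \<open>R_mult_window_le\<close>):
  \<open>R(X) (H - M) \<le> (\<Sum>X < n \<le> X + H. \<tau>(n))\<close>.

  By definition of \<open>\<Delta>\<close> the right-hand side is at most
  \<open>H (log X + 2\<gamma> + H / X) + \<Delta>(X + H) - \<Delta>(X)\<close>. Dividing by \<open>H - M\<close> gives
  \<open>R(X) \<le> log X + 2\<gamma>\<close> with errors \<open>H / X\<close>, \<open>(\<bar>\<Delta>(X)\<bar> + \<bar>\<Delta>(X + H)\<bar>) / H\<close> and about
  \<open>(M / H) log X\<close> (lemma \<open>R_le_window\<close>). If \<open>\<Delta>(x) = O(x\<^sup>\<theta> (log x)\<^sup>a)\<close>, the first two balance at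
  \<open>H\<^sup>2 = X (X\<^sup>\<theta> (log X)\<^sup>a)\<close>, and both are then of the order claimed. The third is smaller because
  \<open>\<tau>(n) = O(n\<^sup>\<epsilon>)\<close> for every \<open>\<epsilon> > 0\<close> (theorem \<open>divisor_count_bound\<close>); the choice \<open>\<epsilon> = \<theta> / 2\<close>
  leaves room for the logarithm.

  The unconditional bound is the case \<open>\<theta> = 1 / 2\<close>, \<open>a = 0\<close>, which is Dirichlet's theorem
  (\<open>dirichlet_divisor_bound\<close>). For the exponent-only version, an exponent \<open>\<theta>\<close> gives
  the admissible pairs \<open>(\<theta> + \<eta>, 0)\<close> for all small \<open>\<eta> > 0\<close>.
\<close>

section \<open>The pointwise divisor bound\<close>

lemma divisor_count_pos: "n > 0 \<Longrightarrow> divisor_count n > 0"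
  unfolding divisor_count_def by (subst card_gt_0_iff) (auto intro: exI[of _ 1])

lemma divisor_count_mult_le:
  assumes "m > 0" "n > 0"
  shows "divisor_count (m * n) \<le> divisor_count m * divisor_count n"
proof -
  let ?D = "\<lambda>n::nat. {d. d dvd n}"
  have "?D (m * n) \<subseteq> (\<lambda>(a, b). a * b) ` (?D m \<times> ?D n)"
    by (auto elim!: dvd_productE)
  then have "card (?D (m * n)) \<le> card (?D m \<times> ?D n)"
    using assms by (intro surj_card_le) auto
  then show ?thesis
    by (simp add: divisor_count_def card_cartesian_product)
qed

lemma divisor_count_prod_le:
  assumes "finite A" "\<And>x. x \<in> A \<Longrightarrow> f x > 0"
  shows "divisor_count (\<Prod>x\<in>A. f x) \<le> (\<Prod>x\<in>A. divisor_count (f x))"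
  using assms
proof (induction A rule: finite_induct)
  case empty
  then show ?case by (simp add: divisor_count_def)
next
  case (insert x A)
  have "divisor_count (f x * prod f A) \<le> divisor_count (f x) * divisor_count (prod f A)"
    using insert.prems by (intro divisor_count_mult_le) (auto intro: prod_pos)
  also have "\<dots> \<le> divisor_count (f x) * (\<Prod>x\<in>A. divisor_count (f x))"
    using insert by (intro mult_le_mono) auto
  finally show ?case using insert by simp
qed

lemma divisor_count_prime_power:
  assumes "prime p"
  shows "divisor_count (p ^ k) = k + 1"
proof -
  have "{d. d dvd p ^ k} = (\<lambda>i. p ^ i) ` {..k}"
    using assms by (auto simp: divides_primepow_nat)
  moreover have "inj_on (\<lambda>i. p ^ i) {..k}"
    using prime_gt_1_nat[OF assms] by (auto simp: inj_on_def)
  ultimately show ?thesis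
    by (simp add: divisor_count_def card_image)
qed

text \<open>
  For a prime power, \<open>\<tau>(p\<^sup>a) = a + 1\<close> is to be compared with \<open>p\<^bsup>\<epsilon>a\<^esup>\<close>. For large \<open>p\<close> the latter is
  at least \<open>2\<^sup>a\<close> and no constant is needed. It is this constant \<open>1\<close> that makes the product over all
  prime factors bounded uniformly in \<open>n\<close>: only the finitely many small primes cost a factor,
  obtained for them from \<open>2\<^bsup>\<epsilon>a\<^esup> \<ge> 1 + \<epsilon> a log 2\<close>.
\<close>

lemma prime_power_divisor_bound:
  fixes \<epsilon> :: real and p a :: nat
  assumes "\<epsilon> > 0" "p \<ge> 2"
  shows "real (a + 1) \<le>
    (if p powr \<epsilon> \<ge> 2 then 1 else max 1 (1 / (\<epsilon> * ln 2))) * real (p ^ a) powr \<epsilon>"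
proof (cases "p powr \<epsilon> \<ge> 2")
  case True
  have "real (a + 1) \<le> 2 ^ a"
    by (metis Suc_eq_plus1 Suc_leI less_exp of_nat_le_iff of_nat_numeral of_nat_power)
  also have "\<dots> \<le> (p powr \<epsilon>) ^ a"
    using True by (intro power_mono) auto
  also have "\<dots> = real (p ^ a) powr \<epsilon>"
    using assms by (simp add: powr_powr powr_realpow[symmetric] mult.commute)
  finally show ?thesis using True by simp
next
  case False
  define K where "K = max 1 (1 / (\<epsilon> * ln 2))"
  have c: "\<epsilon> * ln 2 > 0" using assms by simp
  have K: "K \<ge> 1" "K * (\<epsilon> * ln 2) \<ge> 1"
  proof -
    show "K \<ge> 1" by (simp add: K_def)
    have "1 / (\<epsilon> * ln 2) * (\<epsilon> * ln 2) \<le> K * (\<epsilon> * ln 2)"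
      using c by (intro mult_right_mono) (auto simp: K_def)
    moreover have "1 / y * y = 1" if "y > 0" for y :: real using that by simp
    note this[OF c]
    ultimately show "K * (\<epsilon> * ln 2) \<ge> 1" by simp
  qed
  have "real (a + 1) \<le> K + (K * (\<epsilon> * ln 2)) * real a"
    using K mult_right_mono[OF K(2), of "real a"] by simp
  also have "\<dots> = K * (1 + a * \<epsilon> * ln 2)"
    by (simp add: algebra_simps)
  also have "\<dots> \<le> K * exp (a * \<epsilon> * ln 2)"
    using K by (intro mult_left_mono exp_ge_add_one_self) auto
  also have "exp (a * \<epsilon> * ln 2) = (2 ^ a) powr \<epsilon>"
    by (simp add: powr_def ln_realpow mult_ac)
  also have "K * (2 ^ a) powr \<epsilon> \<le> K * real (p ^ a) powr \<epsilon>"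
    using K assms by (intro mult_left_mono powr_mono2) (auto intro: power_mono)
  finally show ?thesis using False by (simp add: K_def)
qed

text \<open>
  Submultiplicativity of \<open>\<tau>\<close> splits off the prime powers of \<open>n\<close>, and the primes with \<open>p\<^sup>\<epsilon> < 2\<close> are
  finite in number, so their factors contribute a bounded constant in total.
\<close>

theorem divisor_count_bound:
  fixes \<epsilon> :: real
  assumes "\<epsilon> > 0"
  obtains K where "K \<ge> 1" "\<And>n. n > 0 \<Longrightarrow> real (divisor_count n) \<le> K * real n powr \<epsilon>"
proof -
  define c where "c = max 1 (1 / (\<epsilon> * ln 2))"
  define P where "P = {p::nat. p powr \<epsilon> < 2}"
  have "P \<subseteq> {..nat \<lceil>2 powr (1 / \<epsilon>)\<rceil>}"
  proof
    fix p assume "p \<in> P"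
    then have "(p powr \<epsilon>) powr (1 / \<epsilon>) \<le> 2 powr (1 / \<epsilon>)"
      using assms by (intro powr_mono2) (auto simp: P_def)
    then have "real p \<le> 2 powr (1 / \<epsilon>)"
      using assms by (simp add: powr_powr)
    then show "p \<in> {..nat \<lceil>2 powr (1 / \<epsilon>)\<rceil>}"
      by simp linarith
  qed
  then have fin: "finite P" by (rule finite_subset) simp
  have c1: "c \<ge> 1" by (simp add: c_def)
  show thesis
  proof
    show "c ^ card P \<ge> 1" using c1 by simp
    fix n :: nat assume n: "n > 0"
    let ?S = "prime_factors n" and ?m = "\<lambda>p. multiplicity p n"
    let ?c = "\<lambda>p. if p \<in> P then c else 1"
    have nprod: "n = (\<Prod>p\<in>?S. p ^ ?m p)"
      using n by (rule prime_factorization_nat)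
    have "divisor_count n \<le> (\<Prod>p\<in>?S. divisor_count (p ^ ?m p))"
      by (subst nprod, rule divisor_count_prod_le) (auto intro: prime_gt_0_nat in_prime_factors_imp_prime)
    also have "\<dots> = (\<Prod>p\<in>?S. ?m p + 1)"
      by (intro prod.cong refl divisor_count_prime_power) auto
    finally have "real (divisor_count n) \<le> (\<Prod>p\<in>?S. real (?m p + 1))"
      by (metis of_nat_le_iff of_nat_prod)
    also have "\<dots> \<le> (\<Prod>p\<in>?S. ?c p * real (p ^ ?m p) powr \<epsilon>)"
    proof (intro prod_mono conjI)
      fix p assume "p \<in> ?S"
      then have "p \<ge> 2" by (simp add: prime_ge_2_nat in_prime_factors_imp_prime)
      from prime_power_divisor_bound[OF assms this, of "?m p"]
      show "real (?m p + 1) \<le> ?c p * real (p ^ ?m p) powr \<epsilon>"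
        by (auto simp: P_def c_def split: if_splits)
    qed simp
    also have "\<dots> = (\<Prod>p\<in>?S. ?c p) * (\<Prod>p\<in>?S. real (p ^ ?m p) powr \<epsilon>)"
      by (rule prod.distrib)
    also have "(\<Prod>p\<in>?S. real (p ^ ?m p) powr \<epsilon>) = (\<Prod>p\<in>?S. real (p ^ ?m p)) powr \<epsilon>"
      by (rule prod_powr_distrib[symmetric])
    also have "(\<Prod>p\<in>?S. real (p ^ ?m p)) = real n"
      by (subst (2) nprod) simp
    also have "(\<Prod>p\<in>?S. ?c p) = c ^ card (?S \<inter> P)"
      by (simp add: prod.inter_restrict[symmetric])
    also have "c ^ card (?S \<inter> P) \<le> c ^ card P"
      using c1 fin by (intro power_increasing card_mono) auto
    finally show "real (divisor_count n) \<le> c ^ card P * real n powr \<epsilon>"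
      by (simp add: mult_right_mono)
  qed
qed

section \<open>Components crossing a window\<close>

text \<open>
  Membership of \<open>0\<close> is excluded because \<open>T\<close> fixes \<open>0\<close> (all naturals divide \<open>0\<close>, an infinite
  set of cardinality \<open>0\<close>), whereas orbits have to run to infinity.
\<close>

definition closed_T :: "nat set \<Rightarrow> bool" where
  "closed_T C \<longleftrightarrow> (\<forall>n\<in>C. n > 0 \<and> T n \<in> C)"

lemma T_gt: "n > 0 \<Longrightarrow> n < T n"
  using divisor_count_pos by (simp add: T_def)

lemma component_closed_T:
  assumes "C \<in> pre_digraph.sccs_verts (with_proj \<Gamma>)"
  shows "closed_T C"
proof -
  interpret pair_sym_digraph \<Gamma> by (rule pair_sym_digraph_\<Gamma>)
  have pos: "n > 0" if "n \<in> C" for n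
    using sccs_verts_subsets[OF assms] that by (auto simp: \<Gamma>_def)
  have "T n \<in> C" if n: "n \<in> C" for n
  proof -
    have "(n, T n) \<in> parcs \<Gamma>" using pos[OF n] by (auto simp: \<Gamma>_def)
    then have "n \<rightarrow>\<^sup>*\<^bsub>with_proj \<Gamma>\<^esub> T n" by (rule reachable_adjI)
    with symmetric_reachable'[OF this] n assms show ?thesis
      unfolding in_sccs_verts_conv_reachable by blast
  qed
  with pos show ?thesis by (simp add: closed_T_def)
qed

lemma finite_window [simp]: "finite {n. X < real n \<and> real n \<le> Y}"
  by (rule finite_subset[of _ "{..nat \<lceil>Y\<rceil>}"]) (auto, linarith)

lemma finite_upto [simp]: "finite {n. n > 0 \<and> real n \<le> Y}"
  by (rule finite_subset[of _ "{..nat \<lceil>Y\<rceil>}"]) (auto, linarith)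

text \<open>
  Along the orbit of \<open>m\<close> the divisor counts are the step lengths, so they telescope: the steps
  starting at or below \<open>Y\<close> lead from \<open>m\<close> to a point beyond \<open>Y\<close>.
\<close>

lemma closed_T_sum_ge:
  assumes "closed_T C" "m \<in> C"
  shows "(\<Sum>n | n \<in> C \<and> m \<le> n \<and> real n \<le> Y. real (divisor_count n)) \<ge> Y - real m"
  using assms(2)
proof (induction "nat \<lceil>Y - real m\<rceil>" arbitrary: m rule: less_induct)
  case less
  let ?S = "\<lambda>m. {n. n \<in> C \<and> m \<le> n \<and> real n \<le> Y}"
  have m: "m > 0" "T m \<in> C" using assms(1) less.prems by (auto simp: closed_T_def)
  have fin: "finite (?S k)" for k
    by (rule finite_subset[of _ "{..nat \<lceil>Y\<rceil>}"]) (auto, linarith)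
  show ?case
  proof (cases "real m \<le> Y")
    case False
    have "0 \<le> (\<Sum>n\<in>?S m. real (divisor_count n))" by (intro sum_nonneg) auto
    with False show ?thesis by linarith
  next
    case True
    have gt: "m < T m" by (rule T_gt) fact
    show ?thesis
    proof (cases "real m = Y")
      case True
      then show ?thesis by (simp add: sum_nonneg)
    next
      case False
      then have "nat \<lceil>Y - real (T m)\<rceil> < nat \<lceil>Y - real m\<rceil>"
        using gt True by linarith
      from less.hyps[OF this m(2)]
      have "Y - real m \<le> real (divisor_count m) + (\<Sum>n\<in>?S (T m). real (divisor_count n))"
        by (simp add: T_def)
      also have "\<dots> = (\<Sum>n\<in>insert m (?S (T m)). real (divisor_count n))"
        using fin[of "T m"] gt by (subst sum.insert) auto
      also have "\<dots> \<le> (\<Sum>n\<in>?S m. real (divisor_count n))"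
        using fin[of m] gt True less.prems by (intro sum_mono2) auto
      finally show ?thesis .
    qed
  qed
qed

text \<open>
  The entry point is the image under \<open>T\<close> of the largest element of \<open>C\<close> up to \<open>X\<close>.
\<close>

lemma closed_T_enters_window:
  assumes C: "closed_T C" and meet: "real ` C \<inter> {1..X} \<noteq> {}"
    and M: "\<And>n. n > 0 \<Longrightarrow> real n \<le> X \<Longrightarrow> real (divisor_count n) \<le> M"
  obtains m where "m \<in> C" "X < real m" "real m \<le> X + M"
proof -
  define S where "S = {n \<in> C. real n \<le> X}"
  have "finite S" unfolding S_def
    by (rule finite_subset[of _ "{..nat \<lceil>X\<rceil>}"]) (auto, linarith)
  moreover have "S \<noteq> {}" using meet by (auto simp: S_def)
  ultimately have mx: "Max S \<in> S" "\<And>n. n \<in> S \<Longrightarrow> n \<le> Max S" by auto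
  then have pos: "Max S > 0" and TC: "T (Max S) \<in> C"
    using C by (auto simp: closed_T_def S_def)
  show thesis
  proof
    show "T (Max S) \<in> C" by fact
    show "X < real (T (Max S))"
      using mx(2)[of "T (Max S)"] T_gt[OF pos] TC by (force simp: S_def)
    show "real (T (Max S)) \<le> X + M"
      using M[OF pos] mx(1) by (simp add: T_def S_def)
  qed
qed

text \<open>
  The components meeting \<open>[1, X]\<close> have disjoint traces in the window \<open>(X, X + H]\<close>. Each trace has
  divisor sum at least \<open>H - M\<close>, the distance left to cover after entering the window.
\<close>

lemma R_mult_window_le:
  assumes M: "\<And>n. n > 0 \<Longrightarrow> real n \<le> X \<Longrightarrow> real (divisor_count n) \<le> M"
  shows "real (R X) * (H - M) \<le> (\<Sum>n | X < real n \<and> real n \<le> X + H. real (divisor_count n))"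
proof -
  interpret pair_sym_digraph \<Gamma> by (rule pair_sym_digraph_\<Gamma>)
  define F where "F = {C \<in> sccs_verts. real ` C \<inter> {1..X} \<noteq> {}}"
  define W where "W = {n. X < real n \<and> real n \<le> X + H}"
  let ?t = "\<lambda>n. real (divisor_count n)"
  have disj: "C \<inter> D = {}" if "C \<in> F" "D \<in> F" "C \<noteq> D" for C D
    using that sccs_verts_disjoint by (auto simp: F_def)
  \<comment> \<open>Disjoint sets that all meet \<open>[1, X]\<close> are determined by their finite traces there.\<close>
  have "finite F"
  proof (rule inj_on_finite)
    show "inj_on (\<lambda>C. C \<inter> {n. n > 0 \<and> real n \<le> X}) F"
    proof (rule inj_onI, rule ccontr)
      fix C D assume CD: "C \<in> F" "D \<in> F" "C \<noteq> D"
        and eq: "C \<inter> {n. n > 0 \<and> real n \<le> X} = D \<inter> {n. n > 0 \<and> real n \<le> X}"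
      from CD(1) obtain n where "n \<in> C" "1 \<le> real n" "real n \<le> X" by (auto simp: F_def)
      then have "n \<in> C \<inter> {n. n > 0 \<and> real n \<le> X}" by simp
      then have "n \<in> D" unfolding eq by simp
      with \<open>n \<in> C\<close> disj[OF CD] show False by auto
    qed
    show "(\<lambda>C. C \<inter> {n. n > 0 \<and> real n \<le> X}) ` F \<subseteq> Pow {n. n > 0 \<and> real n \<le> X}" by auto
  qed simp
  have each: "H - M \<le> (\<Sum>n\<in>C \<inter> W. ?t n)" if "C \<in> F" for C
  proof -
    from that have C: "closed_T C" by (auto simp: F_def intro: component_closed_T)
    have "real ` C \<inter> {1..X} \<noteq> {}" using that by (simp add: F_def)
    from closed_T_enters_window[OF C this M]
    obtain m where m: "m \<in> C" "X < real m" "real m \<le> X + M" .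
    have "H - M \<le> (X + H) - real m" using m by simp
    also have "\<dots> \<le> (\<Sum>n | n \<in> C \<and> m \<le> n \<and> real n \<le> X + H. ?t n)"
      using closed_T_sum_ge[OF C m(1)] .
    also have "\<dots> \<le> (\<Sum>n\<in>C \<inter> W. ?t n)"
      using m by (intro sum_mono2) (auto simp: W_def)
    finally show ?thesis .
  qed
  have "real (R X) * (H - M) = (\<Sum>C\<in>F. H - M)"
    by (simp add: R_def F_def)
  also have "\<dots> \<le> (\<Sum>C\<in>F. \<Sum>n\<in>C \<inter> W. ?t n)"
    by (intro sum_mono each)
  also have "\<dots> = (\<Sum>n\<in>(\<Union>C\<in>F. C \<inter> W). ?t n)"
    using \<open>finite F\<close> disj by (intro sum.UNION_disjoint[symmetric]) (auto simp: W_def)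
  also have "\<dots> \<le> (\<Sum>n\<in>W. ?t n)"
    by (intro sum_mono2) (auto simp: W_def)
  finally show ?thesis by (simp add: W_def)
qed

section \<open>Dirichlet's divisor theorem\<close>

lemma card_multiples_le:
  assumes "x \<ge> 0" "d > 0"
  shows "card {e::nat. e > 0 \<and> real d * real e \<le> x} = nat \<lfloor>x / real d\<rfloor>"
proof -
  have "{e::nat. e > 0 \<and> real d * real e \<le> x} = {1..nat \<lfloor>x / real d\<rfloor>}"
    using assms by (auto simp: le_nat_floor field_simps le_nat_iff le_floor_iff)
  then show ?thesis by simp
qed

lemma sum_divisor_count_conv_card:
  "(\<Sum>n | n > 0 \<and> real n \<le> x. divisor_count n)
     = card {(d, e). d > 0 \<and> e > 0 \<and> real d * real e \<le> x}"
proof -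
  let ?N = "{n. n > 0 \<and> real n \<le> x}"
  let ?S = "SIGMA n:?N. {d. d dvd n}"
  have "bij_betw (\<lambda>(n, d). (d, n div d)) ?S {(d, e). d > 0 \<and> e > 0 \<and> real d * real e \<le> x}"
    by (rule bij_betw_byWitness[where f' = "\<lambda>(d, e). (d * e, d)"])
       (auto simp: dvd_def simp flip: of_nat_mult intro: Nat.gr0I)
  then have "card {(d, e). d > 0 \<and> e > 0 \<and> real d * real e \<le> x} = card ?S"
    by (simp add: bij_betw_same_card)
  also have "\<dots> = (\<Sum>n\<in>?N. divisor_count n)"
    by (subst card_SigmaI) (auto simp: divisor_count_def)
  finally show ?thesis ..
qed

text \<open>
  Dirichlet's hyperbola method: a lattice point \<open>(d, e)\<close> with \<open>d e \<le> x\<close> has \<open>d \<le> \<surd>x\<close> or \<open>e \<le> \<surd>x\<close>.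
  The two families are exchanged by reflection and overlap in the square of side \<open>s\<close>.
\<close>

lemma dirichlet_hyperbola:
  assumes "x \<ge> 1"
  defines "s \<equiv> nat \<lfloor>sqrt x\<rfloor>"
  shows "(\<Sum>n | n > 0 \<and> real n \<le> x. real (divisor_count n))
           = 2 * (\<Sum>d=1..s. real_of_int \<lfloor>x / real d\<rfloor>) - real s ^ 2"
proof -
  define P where "P = {(d::nat, e::nat). d > 0 \<and> e > 0 \<and> real d * real e \<le> x}"
  define A where "A = (SIGMA d:{1..s}. {e::nat. e > 0 \<and> real d * real e \<le> x})"
  have sq: "sqrt x \<ge> 1" "sqrt x * sqrt x = x" using assms by auto
  have s: "real s \<le> sqrt x" "sqrt x < real s + 1" using sq by (auto simp: s_def; linarith)+
  have fin: "finite {e::nat. e > 0 \<and> real d * real e \<le> x}" if "d > 0" for d :: nat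
  proof (rule finite_subset[OF _ finite_upto[of x]], safe)
    fix e :: nat assume "real d * real e \<le> x"
    moreover have "1 * real e \<le> real d * real e"
      using that by (intro mult_right_mono) auto
    ultimately show "real e \<le> x" by simp
  qed
  then have finA: "finite A" by (auto simp: A_def)
  have "P = A \<union> prod.swap ` A"
  proof (intro set_eqI iffI)
    fix z assume z: "z \<in> P"
    obtain d e where de: "z = (d, e)" by force
    have "d \<le> s \<or> e \<le> s"
    proof (rule ccontr)
      assume "\<not> ?thesis"
      then have "real s + 1 \<le> real d" "real s + 1 \<le> real e" by linarith+
      with s have "sqrt x < real d" "sqrt x < real e" by linarith+
      then have "sqrt x * sqrt x < real d * real e" using sq \<open>\<not> (d \<le> s \<or> e \<le> s)\<close> by (intro mult_strict_mono) auto
      then show False using z de sq by (simp add: P_def)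
    qed
    then show "z \<in> A \<union> prod.swap ` A" using z
      by (force simp: P_def A_def de mult.commute image_iff)
  qed (auto simp: P_def A_def mult.commute)
  moreover have "A \<inter> prod.swap ` A = {1..s} \<times> {1..s}"
  proof -
    have "real d * real e \<le> x" if "d \<le> s" "e \<le> s" for d e
    proof -
      have "real d * real e \<le> sqrt x * sqrt x"
        using that s sq(1) by (intro mult_mono) linarith+
      then show ?thesis using sq by simp
    qed
    then show ?thesis by (force simp: A_def image_iff)
  qed
  moreover have "card (prod.swap ` A) = card A"
    by (intro card_image) auto
  ultimately have "card P + s * s = 2 * card A"
    using card_Un_Int[OF finA finite_imageI[OF finA, of prod.swap]] by simp
  moreover have "card A = (\<Sum>d=1..s. nat \<lfloor>x / real d\<rfloor>)"
    unfolding A_def using assms fin by (subst card_SigmaI) (auto simp: card_multiples_le)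
  ultimately have "real (card P) + real s * real s = 2 * (\<Sum>d=1..s. real (nat \<lfloor>x / real d\<rfloor>))"
    by (metis (no_types, lifting) of_nat_add of_nat_mult of_nat_numeral of_nat_sum sum.cong)
  moreover have "real (card P) = (\<Sum>n | n > 0 \<and> real n \<le> x. real (divisor_count n))"
    using arg_cong[OF sum_divisor_count_conv_card[of x], of real] by (simp add: P_def)
  moreover have "(\<Sum>d=1..s. real (nat \<lfloor>x / real d\<rfloor>)) = (\<Sum>d=1..s. real_of_int \<lfloor>x / real d\<rfloor>)"
    using assms by (intro sum.cong) auto
  ultimately show ?thesis by (simp add: power2_eq_square)
qed

text \<open>
  In the hyperbola formula \<open>x / d\<close> replaces its floor at a cost of at most \<open>1\<close> for each of the
  \<open>s \<le> \<surd>x\<close> terms, \<open>s\<^sup>2\<close> differs from \<open>x\<close> by at most \<open>2\<surd>x\<close>, and the harmonic sum up to \<open>s\<close> is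
  \<open>log \<surd>x + \<gamma>\<close> up to \<open>1 / \<surd>x\<close>.
\<close>

theorem dirichlet_divisor_bound:
  assumes "x \<ge> 1"
  shows "\<bar>\<Delta> x\<bar> \<le> 6 * sqrt x"
proof -
  define r where "r = sqrt x"
  define s where "s = nat \<lfloor>r\<rfloor>"
  have r: "r \<ge> 1" "x = r * r" using assms by (auto simp: r_def)
  have s: "real s \<le> r" "r < real s + 1" "s \<ge> 1" using r by (auto simp: s_def; linarith)+
  then have s1: "real s \<ge> 1" by simp
  have lnx: "ln x = 2 * ln r" using r by (simp add: ln_mult)
  have inv: "1 / real s \<le> 2 / r" proof -
    have "r \<le> 2 * real s" using s s1 by linarith
    then have "2 / (2 * real s) \<le> 2 / r" using r by (intro divide_left_mono) auto
    then show ?thesis by simp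
  qed
  have ln1: "ln r \<le> ln (real s + 1)" using s r by simp
  have "ln ((real s + 1) / r) \<le> (real s + 1) / r - 1"
    using s r by (intro ln_le_minus_one) auto
  also have "\<dots> \<le> 1 / r" using s r by (simp add: field_simps)
  finally have ln2: "ln (real s + 1) \<le> ln r + 1 / r"
    using s r by (simp add: ln_div)
  have "euler_mascheroni \<in> {harm s - ln (real (Suc s)) + inverse (real (2 * (s + 1)))..
      harm s - ln (real (Suc s)) + inverse (real (2 * s))}"
    using s(3) by (rule euler_mascheroni_bounds)
  moreover have "inverse (real (2 * s)) \<le> 1 / r" "inverse (real (2 * (s + 1))) \<ge> 0"
    using inv by (simp_all add: inverse_eq_divide)
  ultimately have h: "harm s - euler_mascheroni - ln r \<le> 1 / r"
      "harm s - euler_mascheroni - ln r \<ge> - (1 / r)"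
    using ln1 ln2 unfolding atLeastAtMost_iff of_nat_Suc add.commute[of 1 "real s"]
    by linarith+
  have h': "\<bar>x * harm s - x * (euler_mascheroni + ln r)\<bar> \<le> r"
  proof -
    have "\<bar>harm s - euler_mascheroni - ln r\<bar> \<le> 1 / r" using h by linarith
    then have "x * \<bar>harm s - euler_mascheroni - ln r\<bar> \<le> x * (1 / r)"
      using r by (intro mult_left_mono) auto
    moreover have "x * \<bar>harm s - euler_mascheroni - ln r\<bar>
        = \<bar>x * (harm s - euler_mascheroni - ln r)\<bar>"
      using r by (simp add: abs_mult)
    moreover have "x * (1 / r) = r" using r by simp
    ultimately show ?thesis by (simp add: algebra_simps)
  qed
  define F where "F = (\<Sum>d=1..s. real_of_int \<lfloor>x / real d\<rfloor>)"
  have xh: "x * harm s = (\<Sum>d=1..s. x / real d)"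
    by (simp add: harm_def sum_distrib_left divide_inverse)
  have F1: "F \<le> x * harm s"
    unfolding xh F_def by (intro sum_mono) auto
  have "(\<Sum>d=1..s. x / real d) \<le> (\<Sum>d=1..s. real_of_int \<lfloor>x / real d\<rfloor> + 1)"
    by (intro sum_mono) linarith
  then have F2: "x * harm s \<le> F + r"
    unfolding xh F_def using s by (simp add: sum.distrib)
  have s2: "real s ^ 2 \<le> x" "x \<le> real s ^ 2 + 2 * r"
  proof -
    show "real s ^ 2 \<le> x" unfolding power2_eq_square r(2) using s r by (intro mult_mono) auto
    have "(r - real s) * (r + real s) \<le> 1 * (2 * r)"
      using s r by (intro mult_mono) auto
    then show "x \<le> real s ^ 2 + 2 * r"
      by (simp add: r(2) power2_eq_square algebra_simps)
  qed
  have "\<Delta> x = 2 * F - real s ^ 2 - x * ln x - (2 * euler_mascheroni - 1) * x"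
    unfolding \<Delta>_def F_def s_def r_def using dirichlet_hyperbola[OF assms] by simp
  also have "\<dots> = 2 * (F - x * (euler_mascheroni + ln r)) + (x - real s ^ 2)"
    by (simp add: lnx algebra_simps)
  finally have "\<Delta> x = 2 * (F - x * (euler_mascheroni + ln r)) + (x - real s ^ 2)" .
  moreover have "\<bar>F - x * (euler_mascheroni + ln r)\<bar> \<le> 2 * r"
    using h' F1 F2 r(1) unfolding abs_le_iff by linarith
  moreover have "\<bar>x - real s ^ 2\<bar> \<le> 2 * r"
    using s2 r(1) unfolding abs_le_iff by linarith
  moreover have "\<bar>2 * t + u\<bar> \<le> 6 * r" if "\<bar>t\<bar> \<le> 2 * r" "\<bar>u\<bar> \<le> 2 * r" for t u
    using that by linarith
  ultimately show ?thesis unfolding r_def by metis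
qed

section \<open>Optimising the window\<close>

text \<open>
  The main term comes from \<open>(X + H) log (X + H) - X log X \<le> H (log X + 1 + H / X)\<close>; its summand
  \<open>H\<close> cancels the \<open>-1\<close> in \<open>2\<gamma> - 1\<close>. The assumption \<open>2 M \<le> H\<close> allows the factor
  \<open>1 / (1 - M / H)\<close> to be replaced by \<open>1 + 2 M / H\<close>.
\<close>

lemma R_le_window:
  assumes X: "X \<ge> 1" and H: "0 < H" "2 * M \<le> H" and M0: "M \<ge> 0"
    and M: "\<And>n. n > 0 \<Longrightarrow> real n \<le> X \<Longrightarrow> real (divisor_count n) \<le> M"
    and D: "\<bar>\<Delta> X\<bar> + \<bar>\<Delta> (X + H)\<bar> \<le> D"
  shows "real (R X) \<le> (1 + 2 * M / H) * (ln X + 2 * euler_mascheroni + H / X + D / H)"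
proof -
  let ?t = "\<lambda>n. real (divisor_count n)"
  let ?A = "\<lambda>x. \<Sum>n | n > 0 \<and> real n \<le> x. ?t n"
  define L where "L = ln X + 2 * euler_mascheroni + H / X + D / H"
  have "?A (X + H) = ?A X + (\<Sum>n | X < real n \<and> real n \<le> X + H. ?t n)"
    using X H by (subst sum.union_disjoint[symmetric]) (auto intro!: sum.cong)
  then have diff: "(\<Sum>n | X < real n \<and> real n \<le> X + H. ?t n)
      = (X + H) * ln (X + H) - X * ln X + (2 * euler_mascheroni - 1) * H + \<Delta> (X + H) - \<Delta> X"
    by (simp add: \<Delta>_def algebra_simps)
  have "ln (1 + H / X) \<le> H / X"
    using X H by (intro ln_add_one_self_le_self) auto
  moreover have "ln (X + H) = ln X + ln (1 + H / X)"
  proof -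
    have "X + H = X * (1 + H / X)" using X by (simp add: field_simps)
    moreover have "1 + H / X > 0" using X H by (simp add: add_pos_pos)
    ultimately show ?thesis using X by (simp add: ln_mult_pos)
  qed
  ultimately have "(X + H) * ln (X + H) \<le> (X + H) * (ln X + H / X)"
    using X H by (intro mult_left_mono) auto
  also have "\<dots> = X * ln X + H + H * (ln X + H / X)"
    using X by (simp add: field_simps)
  finally have ln: "(X + H) * ln (X + H) - X * ln X \<le> H + H * (ln X + H / X)" by simp
  have "real (R X) * (H - M) \<le> H * (ln X + H / X) + 2 * euler_mascheroni * H + D"
    using R_mult_window_le[OF M, of X H] diff ln D by (simp add: algebra_simps)
  also have "\<dots> = H * L"
    using H by (simp add: L_def field_simps)
  finally have "real (R X) * (H - M) \<le> H * L" .
  then have L: "real (R X) * (H - M) / H \<le> L"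
    using H by (simp add: divide_le_eq mult.commute)
  have "1 \<le> (1 + 2 * M / H) * ((H - M) / H)"
  proof -
    have "0 \<le> M * (H - 2 * M)" using M0 H by simp
    then show ?thesis using H by (simp add: field_simps)
  qed
  then have "real (R X) * 1 \<le> real (R X) * ((1 + 2 * M / H) * ((H - M) / H))"
    by (intro mult_left_mono) auto
  also have "\<dots> = (1 + 2 * M / H) * (real (R X) * (H - M) / H)"
    by (simp add: mult_ac)
  also have "\<dots> \<le> (1 + 2 * M / H) * L"
    using L M0 H by (intro mult_left_mono) auto
  finally show ?thesis by (simp add: L_def)
qed

lemma R_boundI:
  assumes "eventually (\<lambda>X. real (R X) \<le> ln X + 2 * euler_mascheroni + c * g X) at_top"
  shows "R_bound g"
  unfolding R_bound_def
proof (intro exI conjI allI impI)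
  let ?E = "\<lambda>X. max 0 (real (R X) - ln X - 2 * euler_mascheroni)"
  show "?E \<in> O[at_top](g)"
  proof (rule bigoI)
    show "eventually (\<lambda>X. norm (?E X) \<le> \<bar>c\<bar> * norm (g X)) at_top"
      using assms
    proof eventually_elim
      case (elim X)
      have "c * g X \<le> \<bar>c\<bar> * norm (g X)"
        by (metis abs_ge_self abs_mult real_norm_def)
      moreover have "0 \<le> \<bar>c\<bar> * norm (g X)" by simp
      ultimately show ?case using elim by auto
    qed
  qed
qed auto

lemma R_bound_mono:
  assumes "R_bound f" "f \<in> O[at_top](g)"
  shows "R_bound g"
  using assms landau_o.big_trans unfolding R_bound_def by blast

text \<open>
  The window argument uses the error bound at \<open>X\<close> and at \<open>X + H\<close> with \<open>H \<le> X\<close>. The comparison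
  function grows at most by a constant factor on \<open>[X, 2 X]\<close>, so both are controlled by its value at \<open>X\<close>.
\<close>

lemma divisor_error_doubling:
  assumes "admissible_pair \<theta> a"
  obtains c where "c \<ge> 0" "eventually (\<lambda>X. \<forall>y\<in>{X..2 * X}. \<bar>\<Delta> y\<bar> \<le> c * (X powr \<theta> * ln X powr a)) at_top"
proof -
  from assms have pos: "\<theta> > 0" "a \<ge> 0" and O: "\<Delta> \<in> O[at_top](\<lambda>x. x powr \<theta> * ln x powr a)"
    by (auto simp: admissible_pair_def)
  from landau_o.bigE[OF O] obtain k where k: "k > 0"
    "eventually (\<lambda>x. norm (\<Delta> x) \<le> k * norm (x powr \<theta> * ln x powr a)) at_top" by auto
  then obtain x0 where x0: "\<And>x. x \<ge> x0 \<Longrightarrow> \<bar>\<Delta> x\<bar> \<le> k * (x powr \<theta> * ln x powr a)"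
    by (auto simp: eventually_at_top_linorder abs_mult)
  define c where "c = k * (2 powr \<theta> * 2 powr a)"
  show thesis
  proof
    show "c \<ge> 0" using k by (simp add: c_def)
    show "eventually (\<lambda>X. \<forall>y\<in>{X..2 * X}. \<bar>\<Delta> y\<bar> \<le> c * (X powr \<theta> * ln X powr a)) at_top"
      using eventually_ge_at_top[of x0] eventually_ge_at_top[of 2]
    proof eventually_elim
      case (elim X)
      show ?case
      proof
        fix y assume y: "y \<in> {X..2 * X}"
        have "ln y \<le> ln (2 * X)" using y elim by simp
        also have "\<dots> = ln 2 + ln X" using elim by (simp add: ln_mult)
        also have "\<dots> \<le> 2 * ln X" using elim by simp
        finally have "ln y powr a \<le> (2 * ln X) powr a"
          using y elim pos by (intro powr_mono2) auto
        moreover have "y powr \<theta> \<le> (2 * X) powr \<theta>"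
          using y elim pos by (intro powr_mono2) auto
        ultimately have "y powr \<theta> * ln y powr a \<le> (2 * X) powr \<theta> * (2 * ln X) powr a"
          by (intro mult_mono) auto
        also have "\<dots> = 2 powr \<theta> * 2 powr a * (X powr \<theta> * ln X powr a)"
          using elim by (simp add: powr_mult)
        finally have "k * (y powr \<theta> * ln y powr a) \<le> c * (X powr \<theta> * ln X powr a)"
          using k by (simp add: c_def mult_left_mono mult.assoc)
        with x0[of y] y elim show "\<bar>\<Delta> y\<bar> \<le> c * (X powr \<theta> * ln X powr a)" by simp
      qed
    qed
  qed
qed

text \<open>
  With the target error \<open>g\<close> and \<open>H = X g\<close>, both \<open>H / X\<close> and \<open>X\<^sup>\<theta> (log X)\<^sup>a / H\<close> are equal to
  \<open>g\<close>; this is the optimal window length.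
\<close>

theorem R_bound_of_admissible_pair:
  assumes "admissible_pair \<theta> a"
  shows "R_bound (\<lambda>X. X powr (- (1 - \<theta>) / 2) * ln X powr (a / 2))"
proof -
  from assms have \<theta>: "0 < \<theta>" "\<theta> < 1" "a \<ge> 0" by (auto simp: admissible_pair_def)
  define g where "g = (\<lambda>X::real. X powr (- (1 - \<theta>) / 2) * ln X powr (a / 2))"
  obtain c where c: "c \<ge> 0" and
    ev1: "eventually (\<lambda>X. \<forall>y\<in>{X..2 * X}. \<bar>\<Delta> y\<bar> \<le> c * (X powr \<theta> * ln X powr a)) at_top"
    using divisor_error_doubling[OF assms] .
  obtain K where K: "K \<ge> 1" "\<And>n. n > 0 \<Longrightarrow> real (divisor_count n) \<le> K * real n powr (\<theta> / 2)"
    using divisor_count_bound[of "\<theta> / 2"] \<theta> by auto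
  have "(g \<longlongrightarrow> 0) at_top" unfolding g_def using \<theta> by real_asymp
  then have ev2: "eventually (\<lambda>X. g X < 1) at_top" by (rule order_tendstoD) simp
  have "((\<lambda>X. 2 * K * ln X / X powr (\<theta> / 2)) \<longlongrightarrow> 0) at_top" using \<theta> by real_asymp
  then have ev3: "eventually (\<lambda>X. 2 * K * ln X / X powr (\<theta> / 2) < 1) at_top"
    by (rule order_tendstoD) simp
  have ev4: "eventually (\<lambda>X::real. ln X \<ge> 1) at_top" by real_asymp
  have "eventually (\<lambda>X. real (R X) \<le> ln X + 2 * euler_mascheroni + (5 + 4 * c) * g X) at_top"
    using ev1 ev2 ev3 ev4 eventually_ge_at_top[of 1]
  proof eventually_elim
    case (elim X)
    define G where "G = g X"
    define H where "H = X * G"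
    define M where "M = K * X powr (\<theta> / 2)"
    define D where "D = 2 * (c * (X powr \<theta> * ln X powr a))"
    have "X \<noteq> 1" using elim(4) by auto
    then have G: "0 < G" "G \<le> 1" using elim by (auto simp: G_def g_def)
    have H: "0 < H" "H \<le> X" using G elim by (auto simp: H_def mult_left_le)
    have HG: "X powr \<theta> * ln X powr a = H * G"
    proof -
      have "H * G = X powr 1 * (X powr (- (1 - \<theta>) / 2) * X powr (- (1 - \<theta>) / 2)) *
          (ln X powr (a / 2) * ln X powr (a / 2))"
        using elim by (simp add: H_def G_def g_def)
      also have "\<dots> = X powr \<theta> * ln X powr a"
        by (simp only: powr_add[symmetric]) (simp add: field_simps)
      finally show ?thesis ..
    qed
    (* The overshoot stays below g even after multiplication by ln X: half of the exponent theta
       bounds the divisor function, the other half absorbs the logarithm. *)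
    have MH: "2 * M * ln X \<le> H * G"
    proof -
      have "2 * K * ln X \<le> X powr (\<theta> / 2)"
        using elim by (simp add: divide_less_eq)
      then have "2 * K * ln X * X powr (\<theta> / 2) \<le> X powr (\<theta> / 2) * X powr (\<theta> / 2)"
        by (intro mult_right_mono) auto
      also have "\<dots> = X powr \<theta> * 1" by (simp flip: powr_add)
      also have "\<dots> \<le> X powr \<theta> * ln X powr a"
        using elim \<theta> by (intro mult_left_mono ge_one_powr_ge_zero) auto
      finally show ?thesis by (simp add: HG M_def mult_ac)
    qed
    have M0: "M \<ge> 0" using K by (simp add: M_def)
    have "2 * M * 1 \<le> 2 * M * ln X" using elim M0 by (intro mult_left_mono) auto
    also note MH
    also have "H * G \<le> H" using G H by (simp add: mult_left_le)
    finally have M2: "2 * M \<le> H" by simp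
    define \<delta> where "\<delta> = 2 * M / H"
    have \<delta>: "0 \<le> \<delta>" "\<delta> \<le> 1" "\<delta> * ln X \<le> G"
      using M0 H M2 MH by (auto simp: \<delta>_def divide_le_eq mult_ac)
    then have \<delta>G: "\<delta> \<le> G"
      using mult_left_mono[OF \<open>1 \<le> ln X\<close>, of \<delta>] by linarith
    have "real (R X) \<le> (1 + 2 * M / H) * (ln X + 2 * euler_mascheroni + H / X + D / H)"
    proof (rule R_le_window)
      show "real (divisor_count n) \<le> M" if "n > 0" "real n \<le> X" for n
      proof -
        have "real n powr (\<theta> / 2) \<le> X powr (\<theta> / 2)"
          using that \<theta> by (intro powr_mono2) auto
        then have "K * real n powr (\<theta> / 2) \<le> M"
          unfolding M_def using K(1) by (intro mult_left_mono) auto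
        with K(2)[OF that(1)] show ?thesis by linarith
      qed
      have "\<bar>\<Delta> X\<bar> \<le> D / 2" "\<bar>\<Delta> (X + H)\<bar> \<le> D / 2"
        using elim(1,5) H by (auto simp: D_def)
      then show "\<bar>\<Delta> X\<bar> + \<bar>\<Delta> (X + H)\<bar> \<le> D" by simp
    qed (use elim H M2 M0 in auto)
    also have "H / X = G" using elim by (simp add: H_def)
    also have "D / H = 2 * c * G" using H by (simp add: D_def HG)
    also have "(1 + 2 * M / H) * (ln X + 2 * euler_mascheroni + G + 2 * c * G)
      = ln X + 2 * euler_mascheroni + G + 2 * c * G
        + (\<delta> * ln X + \<delta> * (2 * euler_mascheroni) + \<delta> * (G + 2 * c * G))"
      by (simp add: \<delta>_def algebra_simps)
    also have "\<dots> \<le> ln X + 2 * euler_mascheroni + G + 2 * c * G + (G + G * 2 + 1 * (G + 2 * c * G))"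
      using \<delta> \<delta>G G c euler_mascheroni_less_13_over_22 euler_mascheroni_pos
      by (intro add_mono mult_mono order_refl) auto
    also have "\<dots> = ln X + 2 * euler_mascheroni + (5 + 4 * c) * g X"
      by (simp add: G_def algebra_simps)
    finally show ?case .
  qed
  then show ?thesis unfolding g_def by (rule R_boundI)
qed

lemma admissible_pair_half: "admissible_pair (1 / 2) 0"
proof -
  have "\<Delta> \<in> O[at_top](\<lambda>x. x powr (1 / 2) * ln x powr 0)"
  proof (rule bigoI)
    show "eventually (\<lambda>x. norm (\<Delta> x) \<le> 6 * norm (x powr (1 / 2) * ln x powr 0)) at_top"
      using eventually_ge_at_top[of 2]
      by eventually_elim (use dirichlet_divisor_bound in \<open>auto simp: powr_half_sqrt\<close>)
  qed
  then show ?thesis by (simp add: admissible_pair_def)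
qed

theorem theorem3p4:
  shows "R_bound (\<lambda>X. X powr (-1/4))
    \<and> (\<forall>\<theta> a. admissible_pair \<theta> a \<longrightarrow>
          R_bound (\<lambda>X. X powr (- (1 - \<theta>) / 2) * ln X powr (a / 2)))
    \<and> (\<forall>\<theta>. admissible_exponent \<theta> \<longrightarrow>
          (\<forall>\<epsilon>>0. R_bound (\<lambda>X. X powr (- (1 - \<theta>) / 2 + \<epsilon>))))"
proof (intro conjI allI impI)
  show "R_bound (\<lambda>X. X powr (-1/4))"
  proof (rule R_bound_mono[OF R_bound_of_admissible_pair[OF admissible_pair_half]])
    show "(\<lambda>X::real. X powr (- (1 - 1/2) / 2) * ln X powr (0 / 2)) \<in> O(\<lambda>X. X powr (-1/4))"
      by real_asymp
  qed
next
  fix \<theta> a assume "admissible_pair \<theta> a"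
  then show "R_bound (\<lambda>X. X powr (- (1 - \<theta>) / 2) * ln X powr (a / 2))"
    by (rule R_bound_of_admissible_pair)
next
  fix \<theta> \<epsilon> :: real assume \<theta>: "admissible_exponent \<theta>" and \<epsilon>: "\<epsilon> > 0"
  (* Only half of the loss in the exponent of Delta reaches the bound for R, so eta = eps would
     suffice; the second argument of min keeps theta + eta below 1. *)
  define \<eta> where "\<eta> = min \<epsilon> ((1 - \<theta>) / 2)"
  have \<eta>: "\<eta> > 0" "\<eta> \<le> \<epsilon>" "0 < \<theta> + \<eta>" "\<theta> + \<eta> < 1"
    using \<theta> \<epsilon> by (auto simp: \<eta>_def admissible_exponent_def min_def field_simps)
  have "\<Delta> \<in> O[at_top](\<lambda>x. x powr (\<theta> + \<eta>))"
    using \<theta> \<eta> by (simp add: admissible_exponent_def)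
  also have "(\<lambda>x::real. x powr (\<theta> + \<eta>)) \<in> O(\<lambda>x. x powr (\<theta> + \<eta>) * ln x powr 0)"
    by real_asymp
  finally have "admissible_pair (\<theta> + \<eta>) 0"
    using \<eta> by (simp add: admissible_pair_def)
  from R_bound_of_admissible_pair[OF this]
  show "R_bound (\<lambda>X. X powr (- (1 - \<theta>) / 2 + \<epsilon>))"
  proof (rule R_bound_mono)
    have "(\<lambda>X. X powr u * ln X powr (0 / 2)) \<in> O(\<lambda>X. X powr v)" if "u \<le> v" for u v :: real
    proof (rule bigoI)
      show "eventually (\<lambda>X. norm (X powr u * ln X powr (0 / 2)) \<le> 1 * norm (X powr v)) at_top"
        using eventually_ge_at_top[of 2]
      proof eventually_elim
        case (elim X)
        then show ?case using powr_mono[OF that, of X] by simp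
      qed
    qed
    moreover have "- (1 - (\<theta> + \<eta>)) / 2 \<le> - (1 - \<theta>) / 2 + \<epsilon>"
      using \<eta> by (simp add: field_simps)
    ultimately show "(\<lambda>X. X powr (- (1 - (\<theta> + \<eta>)) / 2) * ln X powr (0 / 2))
        \<in> O(\<lambda>X. X powr (- (1 - \<theta>) / 2 + \<epsilon>))" by blast
  qed
qed

end
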